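(* Let $n$ be a positive integer and let $S, T \subseteq [n]$ with $|S|=|T|$. Then $$\sum_{P \in P_n(S,T)} y^{\mathrm{pmaj}(P)} = \prod_{i \in [n]\setminus T} \left(1+y+\cdots+y^{h(i)-1}\right),$$ where $h(i)=|T\cap\{i+1,\dots,n\}|-|S\cap\{i+1,\dots,n\}|$.
   Context: $[n]=\{1,2,\dots,n\}$, and $\Pi_n$ is the set of all set partitions of $[n]$. For $P\in\Pi_n$, the standard representation of $P$ is the graph on vertex set $[n]$ whose edges (arcs) are the pairs $(i,j)$, $i<j$, such that $i$ and $j$ are consecutive elements (in numerical order) of the same block of $P$; $i$ is the left-hand endpoint and $j$ the right-hand endpoint of the arc $(i,j)$. $\min(P)$ (resp. $\max(P)$) is the set of minimal (resp. maximal) elements of the blocks of $P$, and $P_n(S,T)=\{P\in\Pi_n:\min(P)=S,\ \max(P)=T\}$ (possibly empty). For a word $w=a_1a_2\cdots a_t$ of integers, $\mathrm{des}(w)$ is the number of indices $1\le i<t$ with $a_i>a_{i+1}$. The p-major index $\mathrm{pmaj}(P)$ is defined as follows. Let the arcs of $P$ be $(i_1,j_1),\dots,(i_k,j_k)$ with $i_1>i_2>\cdots>i_k$, and give the arc $(i_r,j_r)$ the label $r$. Let $r_1>r_2>\cdots>r_k$ be the right-hand endpoints of the arcs. Words $\sigma(r_1),\dots,\sigma(r_k)$ are defined recursively: $\sigma(r_1)$ is the one-letter word $a$, where $a$ is the label of the arc with right-hand endpoint $r_1$; and $\sigma(r_{i+1})$ is obtained from $\sigma(r_i)$ by deleting the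 labels of all arcs whose left-hand endpoint $\ell$ satisfies $r_{i+1}\le \ell<r_i$, and then adding at the very beginning the letter $b$, the label of the arc with right-hand endpoint $r_{i+1}$. Then $\mathrm{pmaj}(P)=\sum_{i=1}^k\mathrm{des}(\sigma(r_i))$ (equal to $0$ if $P$ has no arcs). Here $y$ is an indeterminate. The factor $1+y+\cdots+y^{h(i)-1}$ means $\sum_{0\le k\le h(i)-1}y^k$, which is the empty sum $0$ if $h(i)\le 0$. *)

theory Defs
  imports "HOL-Library.Disjoint_Sets" "HOL-Computational_Algebra.Polynomial"
begin

definition arcs :: "nat set set \<Rightarrow> (nat \<times> nat) set" where
  "arcs P = {(i, j). \<exists>B\<in>P. i \<in> B \<and> j \<in> B \<and> i < j \<and> (\<forall>k\<in>B. \<not> (i < k \<and> k < j))}"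

definition partitions_min_max :: "nat \<Rightarrow> nat set \<Rightarrow> nat set \<Rightarrow> nat set set set" where
  "partitions_min_max n S T = {P. partition_on {1..n} P \<and> Min ` P = S \<and> Max ` P = T}"

definition des :: "nat list \<Rightarrow> nat" where
  "des w = card {i. Suc i < length w \<and> w ! i > w ! Suc i}"

text \<open>The arcs of a set partition have pairwise distinct left-hand endpoints.  Listed by
  decreasing left-hand endpoint, the \<open>r\<close>-th arc gets label \<open>r\<close> (counting from 1), so the label of
  an arc is the number of arcs starting at or to the right of its left-hand endpoint.\<close>

definition arc_label :: "nat set set \<Rightarrow> nat \<times> nat \<Rightarrow> nat" where
  "arc_label P a = card {b \<in> arcs P. fst a \<le> fst b}"

text \<open>The right-hand endpoints in decreasing order; \<open>right_end P i\<close> is the usual \<open>r\<^sub>i\<^sub>+\<^sub>1\<close>, since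
  lists are indexed from 0.\<close>

definition right_end :: "nat set set \<Rightarrow> nat \<Rightarrow> nat" where
  "right_end P i = rev (sorted_list_of_set (snd ` arcs P)) ! i"

text \<open>The arc is unique when \<open>P\<close> is a set partition and \<open>r\<close> is a right-hand endpoint.\<close>

definition label_at_right_end :: "nat set set \<Rightarrow> nat \<Rightarrow> nat" where
  "label_at_right_end P r = arc_label P (THE a. a \<in> arcs P \<and> snd a = r)"

text \<open>Again indexed from 0: \<open>sigma P i\<close> is the word \<open>\<sigma>(r\<^sub>i\<^sub>+\<^sub>1)\<close>, meaningful for \<open>i < card (arcs P)\<close>.\<close>

fun sigma :: "nat set set \<Rightarrow> nat \<Rightarrow> nat list" where
  "sigma P 0 = [label_at_right_end P (right_end P 0)]"
| "sigma P (Suc i) =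
     label_at_right_end P (right_end P (Suc i)) #
     filter (\<lambda>c. c \<notin> arc_label P ` {a \<in> arcs P. right_end P (Suc i) \<le> fst a \<and> fst a < right_end P i})
       (sigma P i)"

definition pmaj :: "nat set set \<Rightarrow> nat" where
  "pmaj P = (\<Sum>i<card (arcs P). des (sigma P i))"

definition height :: "nat \<Rightarrow> nat set \<Rightarrow> nat set \<Rightarrow> nat \<Rightarrow> int" where
  "height n S T i = int (card (T \<inter> {i+1..n})) - int (card (S \<inter> {i+1..n}))"

end

theory Submission
  imports Defs
begin

text \<open>
  A partition is determined by its arcs, and listing the left-hand endpoints of the arcs by
  increasing right-hand endpoint turns it into a word. For given \<open>S\<close> and \<open>T\<close> the right-hand
  endpoints are always \<open>R = [n] - S\<close> and the left-hand endpoints \<open>L = [n] - T\<close>, and the words that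
  occur are exactly the arrangements of \<open>L\<close> in which each letter is smaller than the right-hand
  endpoint in its place (\<open>arc_words\<close>). Since labels decrease along left-hand endpoints, descents
  of labels are ascents of left-hand endpoints; \<open>\<sigma>(r)\<close> lists the arcs \<open>(l, r')\<close> with
  \<open>l < r \<le> r'\<close> by increasing \<open>r'\<close>. Thus pmaj becomes a statistic \<open>word_pmaj\<close> on words, and
  \<open>sum_partitions_min_max\<close> replaces the sum over partitions by a sum over words.

  The sum over words is evaluated by removing the largest left-hand endpoint \<open>z\<close>. The right-hand
  endpoints above \<open>z\<close> see no further left-hand endpoint, so reading them from left to right the
  word of open arcs just loses its first letter each time. Ascents at position \<open>j\<close> survive
  through exactly \<open>j\<close> of these words, so their total contribution is the sum of the ascent
  positions of the final segment of the word, a major index \<open>asc_maj\<close>. The letter \<open>z\<close> may stand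
  anywhere in this segment, whose length is \<open>h(z)\<close>, and it is invisible to the smaller right-hand
  endpoints. Inserting a new maximum into a word of length \<open>m\<close> in all \<open>m + 1\<close> places raises the
  major index by \<open>0, \<dots>, m\<close>, each once (\<open>insert_max_gain\<close>); this is the factor
  \<open>1 + y + \<dots> + y^(h(z) - 1)\<close>. Removing \<open>z\<close> together with one right-hand endpoint above it leaves
  \<open>h(l)\<close> unchanged for all \<open>l < z\<close>, and induction gives the product (\<open>sum_word_pmaj\<close>).
\<close>

section \<open>Inserting a maximal letter into a word\<close>

fun asc :: "'a::linorder list \<Rightarrow> nat" where
  "asc (x # y # w) = of_bool (x < y) + asc (y # w)"
| "asc _ = 0"

text \<open>The sum of the ascent positions, counted from 1, written as the total number of ascents of
  all suffixes: an ascent at position \<open>j\<close> lies in \<open>j\<close> suffixes.\<close>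

fun asc_maj :: "'a::linorder list \<Rightarrow> nat" where
  "asc_maj [] = 0"
| "asc_maj (x # w) = asc (x # w) + asc_maj w"

definition insert_at :: "nat \<Rightarrow> 'a \<Rightarrow> 'a list \<Rightarrow> 'a list" where
  "insert_at p z w = take p w @ z # drop p w"

lemma insert_at_0 [simp]: "insert_at 0 z w = z # w"
  by (simp add: insert_at_def)

lemma insert_at_Suc [simp]: "insert_at (Suc p) z (x # w) = x # insert_at p z w"
  by (simp add: insert_at_def)

lemma length_insert_at [simp]: "length (insert_at p z w) = Suc (length w)"
  by (simp add: insert_at_def)

lemma set_insert_at [simp]: "set (insert_at p z w) = insert z (set w)"
  by (simp add: insert_at_def) (metis append_take_drop_id set_append)

lemma distinct_insert_at: "distinct (insert_at p z w) \<longleftrightarrow> z \<notin> set w \<and> distinct w"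
proof (induction w arbitrary: p)
  case (Cons x w)
  thus ?case by (cases p) auto
qed (simp add: insert_at_def)

lemma insert_at_append: "insert_at (length X + p) z (X @ Y) = X @ insert_at p z Y"
  by (simp add: insert_at_def)

lemma asc_Cons: "asc (x # w) = of_bool (w \<noteq> [] \<and> x < hd w) + asc w"
  by (cases w) auto

lemma asc_Cons_max: "\<forall>x\<in>set w. x < z \<Longrightarrow> asc (z # w) = asc w"
  by (cases w) auto

lemma hd_insert_at: "0 < p \<Longrightarrow> p \<le> length w \<Longrightarrow> hd (insert_at p z w) = hd w"
  by (cases w; cases p) auto

text \<open>Put \<open>a = asc w\<close>. A new maximum in front moves every ascent one step to the right and gains \<open>a\<close>.
  In the gap of an ascent it creates no additional ascent and only shifts the later ones; over all
  such gaps, from right to left, this gains \<open>0, \<dots>, a - 1\<close>. In any other gap, or at the end, it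
  creates an ascent, and the gains, from left to right, are \<open>a + 1, \<dots>, length w\<close>. So the gain
  \<open>g p\<close> itself tells whether the number of ascents grows, namely iff \<open>a < g p\<close>. Including this in
  the claim makes an induction on the word possible, since prefixing a letter adds to
  \<open>asc_maj\<close> the number of ascents of the longer word.\<close>

lemma insert_max_gain:
  assumes "\<forall>x\<in>set w. x < z"
  shows "\<exists>g. bij_betw g {..length w} {..length w} \<and> g 0 = asc w \<and>
    (\<forall>p\<le>length w. asc_maj (insert_at p z w) = asc_maj w + g p \<and>
                  asc (insert_at p z w) = asc w + of_bool (asc w < g p))"
  using assms
proof (induction w)
  case Nil
  show ?case by (rule exI[of _ id]) auto
next
  case (Cons x w)
  define m where "m = length w"
  define a where "a = asc w"
  from Cons obtain g where bij: "bij_betw g {..m} {..m}" and g0: "g 0 = a"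
    and gain: "\<And>p. p \<le> m \<Longrightarrow> asc_maj (insert_at p z w) = asc_maj w + g p"
    and rise: "\<And>p. p \<le> m \<Longrightarrow> asc (insert_at p z w) = a + of_bool (a < g p)"
    unfolding m_def a_def by auto
  define c :: nat where "c = of_bool (w \<noteq> [] \<and> x < hd w)"
  have c: "c \<le> 1" by (simp add: c_def)
  have ascx: "asc (x # w) = a + c" by (simp add: asc_Cons a_def c_def)
  \<comment> \<open>The places 0 and 1 of \<open>x # w\<close> gain \<open>a\<close> and \<open>a + 1\<close>, in an order that depends on \<open>c\<close>. At the
    later places the gains for \<open>w\<close> other than \<open>a\<close> recur; those above \<open>a\<close> grow by one, because
    there the longer word has one more ascent.\<close>
  define g' where "g' p = (if p = 0 then a + c else if p = 1 then a + 1 - c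
      else g (p - 1) + of_bool (a < g (p - 1)))" for p
  have inj: "inj_on g {..m}" and img: "g ` {..m} = {..m}"
    using bij by (auto simp: bij_betw_def)
  have ga: "g p \<noteq> a" if "0 < p" "p \<le> m" for p
    using inj_onD[OF inj, of p 0] g0 that by auto
  have gm: "g p \<le> m" if "p \<le> m" for p using img that by blast
  have am: "a \<le> m" using gm[of 0] g0 by simp
  have "inj_on g' {..Suc m}"
  proof (rule inj_onI)
    fix p q assume pq: "p \<in> {..Suc m}" "q \<in> {..Suc m}" "g' p = g' q"
    have big: "g' p \<noteq> a \<and> g' p \<noteq> a + 1" if "1 < p" "p \<le> Suc m" for p
      using ga[of "p - 1"] that by (auto simp: g'_def)
    have small: "g' p = a \<or> g' p = a + 1" if "p \<le> 1" for p
      using that c by (auto simp: g'_def le_Suc_eq)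
    show "p = q"
    proof (cases "p \<le> 1")
      case True
      hence "q \<le> 1" using small[of p] big[of q] pq by (metis atMost_iff not_le)
      with True pq(3) c show ?thesis by (auto simp: g'_def le_Suc_eq)
    next
      case False
      hence q: "1 < q" using small[of q] big[of p] pq by (metis atMost_iff not_le)
      have "g (p - 1) \<noteq> a" "g (q - 1) \<noteq> a" using ga[of "p - 1"] ga[of "q - 1"] False q pq by auto
      hence "g (p - 1) = g (q - 1)" using False q pq(3)
        by (auto simp: g'_def of_bool_def split: if_splits)
      hence "p - 1 = q - 1" using inj_onD[OF inj] pq False q by auto
      thus ?thesis using False q by auto
    qed
  qed
  moreover have "g' ` {..Suc m} \<subseteq> {..Suc m}"
  proof (rule image_subsetI)
    fix p assume "p \<in> {..Suc m}"
    thus "g' p \<in> {..Suc m}" using am c gm[of "p - 1"]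
      by (auto simp: g'_def)
  qed
  ultimately have bij': "bij_betw g' {..Suc m} {..Suc m}"
    by (simp add: bij_betw_def endo_inj_surj)
  have main: "asc_maj (insert_at p z (x # w)) = asc_maj (x # w) + g' p \<and>
              asc (insert_at p z (x # w)) = asc (x # w) + of_bool (asc (x # w) < g' p)"
    if p: "p \<le> Suc m" for p
  proof (cases p)
    case 0
    thus ?thesis using Cons.prems asc_Cons_max[of "x # w" z] ascx by (simp add: g'_def)
  next
    case (Suc q)
    show ?thesis
    proof (cases "q = 0")
      case True
      have [simp]: "asc (z # w) = a" using Cons.prems asc_Cons_max[of w z] a_def by simp
      have "x < z" using Cons.prems by simp
      have am': "asc_maj (z # w) = asc_maj w + a" by simp
      show ?thesis using Suc True \<open>x < z\<close> c am' ascx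
        by (auto simp: g'_def)
    next
      case False
      have q: "q \<le> m" using Suc p by simp
      hence w: "w \<noteq> []" using False m_def by auto
      have i: "insert_at q z w \<noteq> []" by (metis length_insert_at length_0_conv nat.distinct(1))
      have "asc (x # insert_at q z w) = c + (a + of_bool (a < g q))"
        using hd_insert_at[of q w z] False q rise[OF q] w i
        by (simp add: asc_Cons c_def m_def)
      thus ?thesis using Suc False ascx gain[OF q] ga[of q] q c
        by (auto simp: g'_def)
    qed
  qed
  show ?case
  proof (intro exI[of _ g'] conjI allI impI)
    show "g' 0 = asc (x # w)" using ascx by (simp add: g'_def)
  qed (use bij' main in \<open>simp_all add: m_def\<close>)
qed

lemma sum_asc_maj_insert_max:
  fixes y :: "'b::comm_semiring_1"
  assumes "\<forall>x\<in>set w. x < z"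
  shows "(\<Sum>p\<le>length w. y ^ asc_maj (insert_at p z w)) =
    y ^ asc_maj w * (\<Sum>k\<le>length w. y ^ k)"
proof -
  from insert_max_gain[OF assms] obtain g where
    bij: "bij_betw g {..length w} {..length w}"
    and gain: "\<And>p. p \<le> length w \<Longrightarrow> asc_maj (insert_at p z w) = asc_maj w + g p" by blast
  have "(\<Sum>p\<le>length w. y ^ asc_maj (insert_at p z w)) = (\<Sum>p\<le>length w. y ^ asc_maj w * y ^ g p)"
    by (intro sum.cong) (auto simp: gain power_add)
  also have "\<dots> = (\<Sum>k\<le>length w. y ^ asc_maj w * y ^ k)"
    by (rule sum.reindex_bij_betw[OF bij])
  finally show ?thesis by (simp add: sum_distrib_left)
qed

section \<open>Words with bounded letters\<close>

text \<open>The first argument lists the right-hand endpoints in increasing order, the second the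
  left-hand endpoints of their arcs. At the right-hand endpoint \<open>r\<close> the open arcs are those in the
  remaining word whose left-hand endpoint lies below \<open>r\<close>.\<close>

fun word_pmaj :: "'a::linorder list \<Rightarrow> 'a list \<Rightarrow> nat" where
  "word_pmaj (r # R) (x # W) = asc (filter (\<lambda>l. l < r) (x # W)) + word_pmaj R W"
| "word_pmaj _ _ = 0"

definition arc_words :: "'a::linorder list \<Rightarrow> 'a set \<Rightarrow> 'a list set" where
  "arc_words R L = {W. distinct W \<and> set W = L \<and> list_all2 (<) W R}"

lemma word_pmaj_eq_asc_maj:
  assumes "length V = length Y" and "\<And>v l. v \<in> set V \<Longrightarrow> l \<in> set Y \<Longrightarrow> l < v"
  shows "word_pmaj V Y = asc_maj Y"
  using assms
proof (induction V Y rule: list_induct2)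
  case (Cons v V x Y)
  hence "filter (\<lambda>l. l < v) (x # Y) = x # Y" by (intro filter_True) auto
  with Cons show ?case by (simp del: filter.simps)
qed simp

text \<open>The letter \<open>z\<close> is filtered out at the right-hand endpoints in \<open>U\<close>, so inserting it changes only
  the contribution of the segment \<open>Y\<close>, where the bounds exceed all letters. Any bound \<open>v0\<close> above
  \<open>z\<close> may be the one that comes with the new letter: bounds above all letters do not influence
  the statistic.\<close>

lemma word_pmaj_insert_max:
  assumes "length X = length U" and "length Y = length V"
    and "\<forall>u\<in>set U. u \<le> z" and "\<forall>v\<in>set (v0 # V). z < v" and "\<forall>l\<in>set Y. l < z"
  obtains d where "word_pmaj (U @ V) (X @ Y) = d + asc_maj Y"
    and "\<And>p. word_pmaj (U @ v0 # V) (X @ insert_at p z Y) = d + asc_maj (insert_at p z Y)"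
proof -
  from assms(1,3) have "\<exists>d. word_pmaj (U @ V) (X @ Y) = d + asc_maj Y \<and>
    (\<forall>p. word_pmaj (U @ v0 # V) (X @ insert_at p z Y) = d + asc_maj (insert_at p z Y))"
  proof (induction X U rule: list_induct2)
    case Nil
    have "word_pmaj (v0 # V) (insert_at p z Y) = asc_maj (insert_at p z Y)" for p
    proof (rule word_pmaj_eq_asc_maj)
      fix v l assume "v \<in> set (v0 # V)" "l \<in> set (insert_at p z Y)"
      hence "z < v" "l \<le> z" using assms(4,5) by auto
      thus "l < v" by simp
    qed (simp add: assms(2))
    moreover have "word_pmaj V Y = asc_maj Y"
    proof (rule word_pmaj_eq_asc_maj)
      fix v l assume "v \<in> set V" "l \<in> set Y"
      hence "z < v" "l < z" using assms(4,5) by auto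
      thus "l < v" by simp
    qed (simp add: assms(2))
    ultimately show ?case by (intro exI[of _ 0]) simp
  next
    case (Cons x X u U)
    then obtain d where d: "word_pmaj (U @ V) (X @ Y) = d + asc_maj Y"
      "\<And>p. word_pmaj (U @ v0 # V) (X @ insert_at p z Y) = d + asc_maj (insert_at p z Y)" by auto
    have "filter (\<lambda>l. l < u) (insert_at p z Y) = filter (\<lambda>l. l < u) (take p Y @ drop p Y)" for p
      unfolding insert_at_def filter_append using Cons.prems by auto
    hence "filter (\<lambda>l. l < u) (x # X @ insert_at p z Y) = filter (\<lambda>l. l < u) (x # X @ Y)" for p
      by simp
    thus ?case using d
      by (intro exI[of _ "asc (filter (\<lambda>l. l < u) (x # X @ Y)) + d"]) (simp del: filter.simps)
  qed
  thus thesis using that by blast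
qed

text \<open>Only bounds in \<open>U\<close> constrain the letters up to \<open>z\<close>, and inserting \<open>z\<close> behind the first
  \<open>length U\<close> letters leaves those letters in place.\<close>

lemma insert_max_in_arc_words_iff:
  assumes "\<forall>u\<in>set U. u \<le> z" and "\<forall>v\<in>set (v0 # V). z < v"
    and "\<forall>l\<in>L. l < z" and "length U \<le> q" and "q \<le> length U + length V"
  shows "insert_at q z W \<in> arc_words (U @ v0 # V) (insert z L) \<and> z \<notin> set W \<longleftrightarrow>
    W \<in> arc_words (U @ V) L"
proof (cases "length W = length U + length V \<and> set W = L")
  case True
  define X Y where "X = take (length U) W" and "Y = drop (length U) W"
  have W: "W = X @ Y" and len: "length X = length U" "length Y = length V"
    using True by (auto simp: X_def Y_def)
  have Y: "\<forall>l\<in>set Y. l < z" using True assms(3) W by auto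
  have zL: "z \<notin> L" using assms(3) by auto
  define p where "p = q - length U"
  have ins: "insert_at q z W = X @ insert_at p z Y"
    using insert_at_append[of X p z Y] assms(4) len W by (simp add: p_def)
  have "list_all2 (<) (insert_at p z Y) (v0 # V)"
  proof (rule list_all2_all_nthI)
    fix n assume n: "n < length (insert_at p z Y)"
    hence "insert_at p z Y ! n \<in> insert z (set Y)" by (metis nth_mem set_insert_at)
    moreover have "(v0 # V) ! n \<in> set (v0 # V)" using n len by (intro nth_mem) simp
    ultimately show "insert_at p z Y ! n < (v0 # V) ! n"
      using assms(2) Y by (metis insert_iff order_less_trans)
  qed (simp add: len)
  moreover have "list_all2 (<) Y V"
  proof (rule list_all2_all_nthI)
    fix n assume n: "n < length Y"
    hence "Y ! n < z" "V ! n \<in> set V" using Y len by auto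
    thus "Y ! n < V ! n" using assms(2) by force
  qed (simp add: len)
  ultimately have "list_all2 (<) (insert_at q z W) (U @ v0 # V) \<longleftrightarrow> list_all2 (<) W (U @ V)"
    by (simp add: ins list_all2_append len) (simp add: W list_all2_append len)
  thus ?thesis using True zL by (auto simp: arc_words_def distinct_insert_at)
next
  case False
  have "\<not> (insert_at q z W \<in> arc_words (U @ v0 # V) (insert z L) \<and> z \<notin> set W)"
  proof
    assume *: "insert_at q z W \<in> arc_words (U @ v0 # V) (insert z L) \<and> z \<notin> set W"
    hence "length (insert_at q z W) = length (U @ v0 # V)" "insert z (set W) = insert z L"
      unfolding arc_words_def by (auto dest: list_all2_lengthD simp del: length_insert_at)
    moreover have "z \<notin> L" using assms(3) by auto
    ultimately show False using False * by auto
  qed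
  moreover have "W \<notin> arc_words (U @ V) L"
    using False by (auto simp: arc_words_def dest: list_all2_lengthD)
  ultimately show ?thesis by blast
qed

text \<open>The bound at the place of \<open>z\<close> exceeds \<open>z\<close>, so this place is not among those bounded by \<open>U\<close>.\<close>

lemma position_of_max:
  assumes "W \<in> arc_words (U @ V) (insert z L)" and "\<forall>u\<in>set U. u \<le> z"
  obtains W' q where "W = insert_at q z W'" "z \<notin> set W'" "length U \<le> q"
    "q \<le> length W'" "length W = length U + length V"
proof -
  have W: "distinct W" "z \<in> set W" "list_all2 (<) W (U @ V)"
    using assms(1) by (auto simp: arc_words_def)
  obtain X Y where XY: "W = X @ z # Y" using W(2) by (metis split_list)
  have len: "length W = length U + length V" using W(3) by (auto dest: list_all2_lengthD)
  have "length U \<le> length X"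
  proof (rule ccontr)
    assume "\<not> ?thesis"
    moreover have "W ! length X < (U @ V) ! length X"
      by (rule list_all2_nthD[OF W(3)]) (simp add: XY)
    ultimately have "z < U ! length X" "U ! length X \<in> set U" by (auto simp: XY nth_append)
    thus False using assms(2) by force
  qed
  show thesis
  proof (rule that)
    show "W = insert_at (length X) z (X @ Y)" using XY by (simp add: insert_at_def)
    show "z \<notin> set (X @ Y)" using W(1) XY by simp
  qed (use \<open>length U \<le> length X\<close> len in simp_all)
qed

lemma remove1_insert_at: "z \<notin> set W \<Longrightarrow> remove1 z (insert_at q z W) = W"
  by (auto simp: insert_at_def remove1_append dest: in_set_takeD)

lemma takeWhile_insert_at: "z \<notin> set W \<Longrightarrow> takeWhile (\<lambda>x. x \<noteq> z) (insert_at q z W) = take q W"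
  unfolding insert_at_def
  by (subst takeWhile_append2) (auto dest: in_set_takeD)

lemma sum_arc_words_insert_max:
  fixes f :: "'a::linorder list \<Rightarrow> 'b::comm_monoid_add"
  assumes "\<forall>u\<in>set U. u \<le> z" and "\<forall>v\<in>set (v0 # V). z < v" and "\<forall>l\<in>L. l < z"
  shows "(\<Sum>W\<in>arc_words (U @ v0 # V) (insert z L). f W) =
    (\<Sum>W\<in>arc_words (U @ V) L. \<Sum>p\<le>length V. f (insert_at (length U + p) z W))"
proof -
  let ?h = "\<lambda>W p. f (insert_at (length U + p) z W)"
  have len: "length W = length U + length V" if "W \<in> arc_words (U @ V) L" for W
    using that by (auto simp: arc_words_def dest: list_all2_lengthD)
  have "(\<Sum>W\<in>arc_words (U @ v0 # V) (insert z L). f W) =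
      (\<Sum>(W, p)\<in>arc_words (U @ V) L \<times> {..length V}. ?h W p)"
  proof (rule sum.reindex_bij_witness[where
        i = "\<lambda>(W, p). insert_at (length U + p) z W" and
        j = "\<lambda>W. (remove1 z W, length (takeWhile (\<lambda>x. x \<noteq> z) W) - length U)"])
    fix W assume W: "W \<in> arc_words (U @ v0 # V) (insert z L)"
    from position_of_max[OF this assms(1)] obtain W' q where q:
      "W = insert_at q z W'" "z \<notin> set W'" "length U \<le> q" "q \<le> length W'"
      "length W = length U + length (v0 # V)" .
    have q': "q \<le> length U + length V" using q by simp
    have tk: "remove1 z W = W'" "length (takeWhile (\<lambda>x. x \<noteq> z) W) = q"
      using q by (auto simp: remove1_insert_at takeWhile_insert_at)
    show "(case (remove1 z W, length (takeWhile (\<lambda>x. x \<noteq> z) W) - length U) of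
          (W, p) \<Rightarrow> insert_at (length U + p) z W) = W"
      using tk q by simp
    show "(remove1 z W, length (takeWhile (\<lambda>x. x \<noteq> z) W) - length U)
        \<in> arc_words (U @ V) L \<times> {..length V}"
    proof -
      have "W' \<in> arc_words (U @ V) L"
        by (rule iffD1[OF insert_max_in_arc_words_iff[OF assms q(3) q']]) (use W q(1,2) in simp)
      thus ?thesis using tk q' by simp
    qed
    show "(case (remove1 z W, length (takeWhile (\<lambda>x. x \<noteq> z) W) - length U) of
          (W, p) \<Rightarrow> f (insert_at (length U + p) z W)) = f W"
      using tk q by simp
  next
    fix Wp assume "Wp \<in> arc_words (U @ V) L \<times> {..length V}"
    then obtain W p where Wp: "Wp = (W, p)" "W \<in> arc_words (U @ V) L" "p \<le> length V" by auto
    have "insert_at (length U + p) z W \<in> arc_words (U @ v0 # V) (insert z L) \<and> z \<notin> set W"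
      by (subst insert_max_in_arc_words_iff[OF assms]) (use Wp in simp_all)
    thus "(case Wp of (W, p) \<Rightarrow> insert_at (length U + p) z W) \<in> arc_words (U @ v0 # V) (insert z L)"
      and "(remove1 z (case Wp of (W, p) \<Rightarrow> insert_at (length U + p) z W),
        length (takeWhile (\<lambda>x. x \<noteq> z) (case Wp of (W, p) \<Rightarrow> insert_at (length U + p) z W))
          - length U) = Wp"
      using Wp len[of W] by (auto simp: remove1_insert_at takeWhile_insert_at)
  qed
  also have "\<dots> = (\<Sum>W\<in>arc_words (U @ V) L. \<Sum>p\<le>length V. ?h W p)"
    by (simp add: sum.cartesian_product)
  finally show ?thesis .
qed

text \<open>The exponent bound \<open>h(l)\<close> uses truncated subtraction, which gives the intended empty sum when
  there are fewer bounds above \<open>l\<close> than larger letters. The hypothesis on cardinalities excludes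
  the case that the product is nonzero although no word has the right length.\<close>

lemma sum_word_pmaj:
  fixes y :: "'b::comm_semiring_1" and L :: "'a::linorder set"
  assumes "finite L" and "sorted_wrt (<) R" and "card L = length R"
  shows "(\<Sum>W\<in>arc_words R L. y ^ word_pmaj R W) =
    (\<Prod>l\<in>L. \<Sum>k<card {r\<in>set R. l < r} - card {l'\<in>L. l < l'}. y ^ k)"
  using assms
proof (induction L arbitrary: R rule: finite_linorder_max_induct)
  case empty
  have R: "R = []" using empty.prems(2) by simp
  have "arc_words [] {} = {[] :: 'a list}" by (auto simp: arc_words_def)
  thus ?case unfolding R by simp
next
  case (insert z L)
  let ?h = "\<lambda>R L l. card {r\<in>set R. l < r} - card {l'\<in>L. l < l'}"
  have zL: "z \<notin> L" using insert(2) by auto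
  define U where "U = takeWhile (\<lambda>r. r \<le> z) R"
  define V' where "V' = dropWhile (\<lambda>r. r \<le> z) R"
  have R: "R = U @ V'" by (simp add: U_def V'_def)
  have U: "\<forall>u\<in>set U. u \<le> z" by (auto simp: U_def dest: set_takeWhileD)
  have V': "\<forall>v\<in>set V'. z < v"
  proof (cases V')
    case (Cons v V)
    hence "z < v" unfolding V'_def by (metis dropWhile_eq_Cons_conv not_le)
    thus ?thesis using insert.prems(1) Cons R by (auto simp: sorted_wrt_append)
  qed simp
  have none: "{l'\<in>insert z L. z < l'} = {}" using insert(2) by auto
  show ?case
  proof (cases V')
    case Nil
    \<comment> \<open>No bound exceeds \<open>z\<close>: then no word is possible, and the factor of \<open>z\<close> is an empty sum.\<close>
    have "arc_words R (insert z L) = {}"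
    proof (rule ccontr)
      assume "arc_words R (insert z L) \<noteq> {}"
      then obtain W where "W \<in> arc_words (U @ []) (insert z L)" using R Nil by blast
      from position_of_max[OF this U] obtain W' q where "W = insert_at q z W'"
        "length U \<le> q" "q \<le> length W'" "length W = length U + length ([] :: 'a list)" .
      thus False by simp
    qed
    moreover have "{r\<in>set R. z < r} = {}" using U unfolding R Nil by auto
    hence "(\<Sum>k<?h R (insert z L) z. y ^ k) = 0" unfolding none by (simp del: Collect_empty_eq)
    ultimately show ?thesis using zL insert(1) by simp
  next
    case (Cons v V)
    note V = V'[unfolded Cons]
    have RV: "R = U @ v # V" using R Cons by simp
    have "(\<Sum>W\<in>arc_words R (insert z L). y ^ word_pmaj R W) =
      (\<Sum>W\<in>arc_words (U @ V) L. \<Sum>p\<le>length V. y ^ word_pmaj R (insert_at (length U + p) z W))"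
      unfolding RV by (rule sum_arc_words_insert_max[OF U V insert(2)])
    also have "\<dots> = (\<Sum>W\<in>arc_words (U @ V) L. y ^ word_pmaj (U @ V) W * (\<Sum>k\<le>length V. y ^ k))"
    proof (rule sum.cong[OF refl])
      fix W assume W: "W \<in> arc_words (U @ V) L"
      define X Y where "X = take (length U) W" and "Y = drop (length U) W"
      have len: "length X = length U" "length Y = length V" and WXY: "W = X @ Y"
        using W by (auto simp: X_def Y_def arc_words_def dest: list_all2_lengthD)
      have Y: "\<forall>l\<in>set Y. l < z" using W insert(2) WXY by (auto simp: arc_words_def)
      from word_pmaj_insert_max[OF len U V Y] obtain d where
        d: "word_pmaj (U @ V) W = d + asc_maj Y"
        and "\<And>p. word_pmaj R (X @ insert_at p z Y) = d + asc_maj (insert_at p z Y)"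
        unfolding RV WXY by blast
      hence ins: "word_pmaj R (insert_at (length U + p) z W) = d + asc_maj (insert_at p z Y)" for p
        by (simp add: WXY insert_at_append flip: len(1))
      have "(\<Sum>p\<le>length V. y ^ word_pmaj R (insert_at (length U + p) z W)) =
          y ^ d * (\<Sum>p\<le>length Y. y ^ asc_maj (insert_at p z Y))"
        unfolding ins by (simp add: power_add sum_distrib_left len)
      also have "\<dots> = y ^ word_pmaj (U @ V) W * (\<Sum>k\<le>length V. y ^ k)"
        by (simp only: sum_asc_maj_insert_max[OF Y] d power_add mult.assoc) (simp only: len)
      finally show "(\<Sum>p\<le>length V. y ^ word_pmaj R (insert_at (length U + p) z W)) =
          y ^ word_pmaj (U @ V) W * (\<Sum>k\<le>length V. y ^ k)" .
    qed
    also have "\<dots> = (\<Sum>W\<in>arc_words (U @ V) L. y ^ word_pmaj (U @ V) W) * (\<Sum>k\<le>length V. y ^ k)"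
      by (simp add: sum_distrib_right)
    finally have split: "(\<Sum>W\<in>arc_words R (insert z L). y ^ word_pmaj R W) =
      (\<Sum>W\<in>arc_words (U @ V) L. y ^ word_pmaj (U @ V) W) * (\<Sum>k\<le>length V. y ^ k)" .
    have "(\<Sum>W\<in>arc_words (U @ V) L. y ^ word_pmaj (U @ V) W) =
        (\<Prod>l\<in>L. \<Sum>k<?h (U @ V) L l. y ^ k)"
    proof (rule insert.IH)
      show "sorted_wrt (<) (U @ V)" using insert.prems(1) RV by (auto simp: sorted_wrt_append)
      show "card L = length (U @ V)" using insert.prems(2) RV zL insert(1) by simp
    qed
    also have "\<dots> = (\<Prod>l\<in>L. \<Sum>k<?h R (insert z L) l. y ^ k)"
    proof (rule prod.cong[OF refl])
      fix l assume l: "l \<in> L"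
      have v: "l < z" "l < v" "v \<notin> set (U @ V)"
      proof -
        show "l < z" using l insert(2) by blast
        moreover have "z < v" using V by simp
        ultimately show "l < v" by simp
        show "v \<notin> set (U @ V)" using insert.prems(1) RV by (auto simp: sorted_wrt_append)
      qed
      have "{r\<in>set R. l < r} = insert v {r\<in>set (U @ V). l < r}" using v RV by auto
      hence "card {r\<in>set R. l < r} = Suc (card {r\<in>set (U @ V). l < r})"
        using v(3) by simp
      moreover have "{l'\<in>insert z L. l < l'} = insert z {l'\<in>L. l < l'}" using v by auto
      hence "card {l'\<in>insert z L. l < l'} = Suc (card {l'\<in>L. l < l'})"
        using zL insert(1) by simp
      ultimately show "(\<Sum>k<?h (U @ V) L l. y ^ k) = (\<Sum>k<?h R (insert z L) l. y ^ k)" by simp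
    qed
    finally have rest: "(\<Sum>W\<in>arc_words (U @ V) L. y ^ word_pmaj (U @ V) W) =
        (\<Prod>l\<in>L. \<Sum>k<?h R (insert z L) l. y ^ k)" .
    have top: "(\<Sum>k\<le>length V. y ^ k) = (\<Sum>k<?h R (insert z L) z. y ^ k)"
    proof -
      have "{r\<in>set R. z < r} = set (v # V)" using RV U V by auto
      moreover have "distinct (v # V)"
        using insert.prems(1) RV by (auto simp: sorted_wrt_append strict_sorted_iff)
      ultimately have "card {r\<in>set R. z < r} = Suc (length V)"
        using distinct_card[of "v # V"] by simp
      thus ?thesis unfolding none by (simp add: lessThan_Suc_atMost del: Collect_empty_eq)
    qed
    show ?thesis unfolding split rest top using zL insert(1)
      by (simp only: prod.insert mult.commute not_False_eq_True)
  qed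
qed

section \<open>Partitions and their arcs\<close>

definition arc_diagram :: "(nat \<times> nat) set \<Rightarrow> bool" where
  "arc_diagram E \<longleftrightarrow> inj_on fst E \<and> inj_on snd E \<and> (\<forall>(i, j)\<in>E. i < j)"

text \<open>The minimum of the block of \<open>x\<close>, reached by following arcs to the left. The guard \<open>i < x\<close> makes the
  recursion terminate for every relation \<open>E\<close>; in an arc diagram it always holds.\<close>

function root :: "(nat \<times> nat) set \<Rightarrow> nat \<Rightarrow> nat" where
  "root E x = (if \<exists>i<x. (i, x) \<in> E then root E (SOME i. i < x \<and> (i, x) \<in> E) else x)"
  by auto
termination
proof (relation "measure snd", goal_cases)
  case (2 E x)
  hence "(SOME i. i < x \<and> (i, x) \<in> E) < x \<and> (SOME i. i < x \<and> (i, x) \<in> E, x) \<in> E"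
    by (rule someI2_ex) auto
  thus ?case by simp
qed simp

declare root.simps [simp del]

definition blocks :: "nat \<Rightarrow> (nat \<times> nat) set \<Rightarrow> nat set set" where
  "blocks n E = (\<lambda>x. {y \<in> {1..n}. root E y = root E x}) ` {1..n}"

lemma arc_diagramD:
  assumes "arc_diagram E"
  shows "(i, j) \<in> E \<Longrightarrow> i < j" "(i, j) \<in> E \<Longrightarrow> (i', j) \<in> E \<Longrightarrow> i = i'"
    "(i, j) \<in> E \<Longrightarrow> (i, j') \<in> E \<Longrightarrow> j = j'"
  using assms by (auto simp: arc_diagram_def inj_on_def) force+

lemma root_arc:
  assumes "arc_diagram E" "(i, j) \<in> E"
  shows "root E j = root E i"
proof -
  have "i < j" using arc_diagramD[OF assms(1)] assms(2) by blast
  moreover have "(SOME i. i < j \<and> (i, j) \<in> E) = i"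
    using arc_diagramD[OF assms(1)] assms(2) by (intro some_equality) auto
  ultimately show ?thesis using assms(2) by (subst root.simps) auto
qed

lemma root_self: "x \<notin> snd ` E \<Longrightarrow> root E x = x"
  by (subst root.simps) force

lemma root_le: "arc_diagram E \<Longrightarrow> root E x \<le> x"
proof (induction x rule: less_induct)
  case (less x)
  show ?case
  proof (cases "x \<in> snd ` E")
    case True
    then obtain i where i: "(i, x) \<in> E" by auto
    thus ?thesis using less.IH[of i] root_arc[OF less.prems i] arc_diagramD(1)[OF less.prems i]
      less.prems by simp
  qed (simp add: root_self)
qed

text \<open>If \<open>x\<close> lies strictly under the arc \<open>(i, y)\<close> and has the same root, then it cannot be the root,
  which is at most \<open>i\<close>, so it ends an arc \<open>(j, x)\<close>. Here \<open>j \<noteq> i\<close> since left-hand endpoints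
  determine arcs. If \<open>i < j\<close>, then \<open>j\<close> lies under \<open>(i, y)\<close>; if \<open>j < i\<close>, then \<open>i\<close> lies under
  \<open>(j, x)\<close>. In both cases a vertex smaller than \<open>x\<close> has the same defect. Hence the vertices with
  a common root form a chain of arcs.\<close>

lemma no_vertex_under_arc_in_block:
  assumes E: "arc_diagram E"
  shows "(i, y) \<in> E \<Longrightarrow> root E x = root E y \<Longrightarrow> i < x \<Longrightarrow> x < y \<Longrightarrow> False"
proof (induction x arbitrary: i y rule: less_induct)
  case (less x)
  have "x \<in> snd ` E"
  proof (rule ccontr)
    assume "x \<notin> snd ` E"
    hence "x = root E i" using root_self root_arc[OF E less.prems(1)] less.prems(2) by simp
    thus False using root_le[OF E, of i] less.prems(3) by simp
  qed
  then obtain j where j: "(j, x) \<in> E" by auto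
  hence jx: "j < x" "root E x = root E j" using arc_diagramD(1)[OF E] root_arc[OF E] by auto
  consider "i = j" | "i < j" | "j < i" by linarith
  thus False
  proof cases
    case 1
    thus False using arc_diagramD(3)[OF E] j less.prems by auto
  next
    case 2
    thus False using less.IH[of j i y] jx less.prems by simp
  next
    case 3
    thus False using less.IH[of i j x] j less.prems root_arc[OF E less.prems(1)] by simp
  qed
qed

lemma partition_on_blocks: "partition_on {1..n} (blocks n E)"
  unfolding partition_on_def disjoint_def blocks_def by auto

lemma arcs_blocks:
  assumes E: "arc_diagram E" and sub: "E \<subseteq> {1..n} \<times> {1..n}"
  shows "arcs (blocks n E) = E"
proof (rule set_eqI, clarify)
  fix i j
  have same: "(\<exists>B\<in>blocks n E. i \<in> B \<and> j \<in> B \<and> Q B) \<longleftrightarrow>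
      i \<in> {1..n} \<and> j \<in> {1..n} \<and> root E i = root E j \<and> Q {y \<in> {1..n}. root E y = root E j}" for Q
  proof
    assume "\<exists>B\<in>blocks n E. i \<in> B \<and> j \<in> B \<and> Q B"
    then obtain x where x: "i \<in> {1..n}" "j \<in> {1..n}" "root E i = root E x" "root E j = root E x"
      "Q {y \<in> {1..n}. root E y = root E x}" unfolding blocks_def by blast
    thus "i \<in> {1..n} \<and> j \<in> {1..n} \<and> root E i = root E j \<and>
        Q {y \<in> {1..n}. root E y = root E j}" by simp
  next
    assume "i \<in> {1..n} \<and> j \<in> {1..n} \<and> root E i = root E j \<and>
        Q {y \<in> {1..n}. root E y = root E j}"
    thus "\<exists>B\<in>blocks n E. i \<in> B \<and> j \<in> B \<and> Q B" unfolding blocks_def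
      by (intro bexI[of _ "{y \<in> {1..n}. root E y = root E j}"]) auto
  qed
  show "(i, j) \<in> arcs (blocks n E) \<longleftrightarrow> (i, j) \<in> E"
  proof
    assume ij: "(i, j) \<in> E"
    hence "i \<in> {1..n} \<and> j \<in> {1..n} \<and> root E i = root E j \<and> i < j \<and>
        (\<forall>k\<in>{y \<in> {1..n}. root E y = root E j}. \<not> (i < k \<and> k < j))"
      using sub root_arc[OF E ij] arc_diagramD(1)[OF E ij] no_vertex_under_arc_in_block[OF E ij]
      by auto
    thus "(i, j) \<in> arcs (blocks n E)" by (simp add: arcs_def same)
  next
    assume "(i, j) \<in> arcs (blocks n E)"
    hence ij: "root E i = root E j" "i < j"
      "\<And>k. k \<in> {1..n} \<Longrightarrow> root E k = root E j \<Longrightarrow> \<not> (i < k \<and> k < j)"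
      by (auto simp: arcs_def same)
    have "j \<in> snd ` E" using root_self[of j E] root_le[OF E, of i] ij by force
    then obtain k where k: "(k, j) \<in> E" by auto
    have kj: "k < j" "root E k = root E j" "k \<in> {1..n}"
      using arc_diagramD(1)[OF E k] root_arc[OF E k] k sub by auto
    have "\<not> i < k" using ij(3)[of k] kj by auto
    moreover have "\<not> k < i" using no_vertex_under_arc_in_block[OF E k, of i] ij by auto
    ultimately show "(i, j) \<in> E" using k by (simp add: not_less le_antisym)
  qed
qed

lemma block_eqI: "partition_on A P \<Longrightarrow> B \<in> P \<Longrightarrow> C \<in> P \<Longrightarrow> x \<in> B \<Longrightarrow> x \<in> C \<Longrightarrow> B = C"
  unfolding partition_on_def disjoint_def by blast

lemma block_of: "partition_on A P \<Longrightarrow> x \<in> A \<Longrightarrow> \<exists>B\<in>P. x \<in> B"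
  unfolding partition_on_def by blast

lemma in_block: "partition_on A P \<Longrightarrow> B \<in> P \<Longrightarrow> x \<in> B \<Longrightarrow> x \<in> A"
  unfolding partition_on_def by blast

lemma finite_block: "partition_on {1..n::nat} P \<Longrightarrow> B \<in> P \<Longrightarrow> finite B"
  by (rule finite_subset[of _ "{1..n}"]) (rule subsetI, erule (2) in_block, simp)

lemma arc_diagram_arcs:
  assumes P: "partition_on {1..n::nat} P"
  shows "arc_diagram (arcs P)"
proof -
  have "i = i'" if "(i, j) \<in> arcs P" "(i', j) \<in> arcs P" for i i' j
  proof -
    from that obtain B C where BC: "B \<in> P" "i \<in> B" "j \<in> B" "i < j" "\<forall>k\<in>B. \<not> (i < k \<and> k < j)"
      "C \<in> P" "i' \<in> C" "j \<in> C" "i' < j" "\<forall>k\<in>C. \<not> (i' < k \<and> k < j)" by (auto simp: arcs_def)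
    from block_eqI[OF P BC(1,6) BC(3,8)] have "B = C" .
    thus ?thesis using BC by (metis linorder_neqE_nat)
  qed
  moreover have "j = j'" if "(i, j) \<in> arcs P" "(i, j') \<in> arcs P" for i j j'
  proof -
    from that obtain B C where BC: "B \<in> P" "i \<in> B" "j \<in> B" "i < j" "\<forall>k\<in>B. \<not> (i < k \<and> k < j)"
      "C \<in> P" "i \<in> C" "j' \<in> C" "i < j'" "\<forall>k\<in>C. \<not> (i < k \<and> k < j')" by (auto simp: arcs_def)
    from block_eqI[OF P BC(1,6) BC(2,7)] have "B = C" .
    thus ?thesis using BC by (metis linorder_neqE_nat)
  qed
  moreover have "i < j" if "(i, j) \<in> arcs P" for i j using that by (auto simp: arcs_def)
  ultimately show ?thesis unfolding arc_diagram_def inj_on_def by auto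
qed

lemma arcs_subset: "partition_on A P \<Longrightarrow> arcs P \<subseteq> A \<times> A"
  unfolding partition_on_def arcs_def by blast

lemma snd_arcs_iff:
  assumes P: "partition_on {1..n::nat} P" and B: "B \<in> P" "x \<in> B"
  shows "x \<in> snd ` arcs P \<longleftrightarrow> x \<noteq> Min B"
proof -
  have fin: "finite B" using finite_block[OF P B(1)] .
  show ?thesis
  proof
    assume "x \<in> snd ` arcs P"
    then obtain i C where C: "C \<in> P" "i \<in> C" "x \<in> C" "i < x" by (auto simp: arcs_def)
    hence "C = B" using block_eqI[OF P C(1) B(1) C(3) B(2)] by blast
    thus "x \<noteq> Min B" using C Min_le[OF fin, of i] by auto
  next
    assume "x \<noteq> Min B"
    hence lt: "Min B < x" using Min_le[OF fin B(2)] by simp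
    let ?A = "{i\<in>B. i < x}"
    have A: "finite ?A" "?A \<noteq> {}" using fin lt Min_in[OF fin] B(2) by (simp, blast)
    have m: "Max ?A \<in> ?A" by (rule Max_in[OF A])
    have "\<not> (Max ?A < k \<and> k < x)" if "k \<in> B" for k
      using Max_ge[OF A(1), of k] that by (metis (mono_tags, lifting) mem_Collect_eq leD)
    hence "(Max ?A, x) \<in> arcs P" using m B unfolding arcs_def by blast
    thus "x \<in> snd ` arcs P" by (rule image_eqI[rotated]) simp
  qed
qed

lemma fst_arcs_iff:
  assumes P: "partition_on {1..n::nat} P" and B: "B \<in> P" "x \<in> B"
  shows "x \<in> fst ` arcs P \<longleftrightarrow> x \<noteq> Max B"
proof -
  have fin: "finite B" using finite_block[OF P B(1)] .
  show ?thesis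
  proof
    assume "x \<in> fst ` arcs P"
    then obtain i C where C: "C \<in> P" "i \<in> C" "x \<in> C" "x < i" by (auto simp: arcs_def)
    hence "C = B" using block_eqI[OF P C(1) B(1) C(3) B(2)] by blast
    thus "x \<noteq> Max B" using C Max_ge[OF fin, of i] by auto
  next
    assume "x \<noteq> Max B"
    hence lt: "x < Max B" using Max_ge[OF fin B(2)] by simp
    let ?A = "{i\<in>B. x < i}"
    have A: "finite ?A" "?A \<noteq> {}" using fin lt Max_in[OF fin] B(2) by (simp, blast)
    have m: "Min ?A \<in> ?A" by (rule Min_in[OF A])
    have "\<not> (x < k \<and> k < Min ?A)" if "k \<in> B" for k
      using Min_le[OF A(1), of k] that by (metis (mono_tags, lifting) mem_Collect_eq leD)
    hence "(x, Min ?A) \<in> arcs P" using m B unfolding arcs_def by blast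
    thus "x \<in> fst ` arcs P" by (rule image_eqI[rotated]) simp
  qed
qed

lemma Min_Max_arcs:
  assumes P: "partition_on {1..n::nat} P"
  shows "Min ` P = {1..n} - snd ` arcs P" and "Max ` P = {1..n} - fst ` arcs P"
proof -
  have fin: "finite B" "B \<noteq> {}" "B \<subseteq> {1..n}" if "B \<in> P" for B
    using finite_block[OF P that] partition_onD3[OF P] in_block[OF P that] that by blast+
  have ex: "\<exists>B\<in>P. x \<in> B" if "x \<in> {1..n}" for x using block_of[OF P that] .
  have "Min B \<in> {1..n} - snd ` arcs P" if "B \<in> P" for B
    using fin[OF that] Min_in[of B] snd_arcs_iff[OF P that, of "Min B"] by blast
  moreover have "x \<in> Min ` P" if "x \<in> {1..n} - snd ` arcs P" for x
  proof -
    have "x \<in> {1..n}" using that by blast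
    from ex[OF this] obtain B where B: "B \<in> P" "x \<in> B" by blast
    hence "x = Min B" using snd_arcs_iff[OF P B] that by blast
    thus ?thesis using B(1) by (rule image_eqI)
  qed
  ultimately show "Min ` P = {1..n} - snd ` arcs P" by (intro equalityI image_subsetI subsetI)
  have "Max B \<in> {1..n} - fst ` arcs P" if "B \<in> P" for B
    using fin[OF that] Max_in[of B] fst_arcs_iff[OF P that, of "Max B"] by blast
  moreover have "x \<in> Max ` P" if "x \<in> {1..n} - fst ` arcs P" for x
  proof -
    have "x \<in> {1..n}" using that by blast
    from ex[OF this] obtain B where B: "B \<in> P" "x \<in> B" by blast
    hence "x = Max B" using fst_arcs_iff[OF P B] that by blast
    thus ?thesis using B(1) by (rule image_eqI)
  qed
  ultimately show "Max ` P = {1..n} - fst ` arcs P" by (intro equalityI image_subsetI subsetI)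
qed

lemma root_arcs:
  assumes P: "partition_on {1..n::nat} P"
  shows "B \<in> P \<Longrightarrow> x \<in> B \<Longrightarrow> root (arcs P) x = Min B"
proof (induction x rule: less_induct)
  case (less x)
  show ?case
  proof (cases "x = Min B")
    case True
    hence "x \<notin> snd ` arcs P" using snd_arcs_iff[OF P less.prems] by blast
    from root_self[OF this] True show ?thesis by (rule trans)
  next
    case False
    then obtain i where i: "(i, x) \<in> arcs P" using snd_arcs_iff[OF P less.prems] by auto
    then obtain C where C: "C \<in> P" "i \<in> C" "x \<in> C" "i < x" by (auto simp: arcs_def)
    hence "i \<in> B" using block_eqI[OF P C(1) less.prems(1) C(3) less.prems(2)] by blast
    from less.IH[OF C(4) less.prems(1) this] show ?thesis
      using root_arc[OF arc_diagram_arcs[OF P] i] by simp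
  qed
qed

lemma blocks_arcs:
  assumes P: "partition_on {1..n::nat} P"
  shows "blocks n (arcs P) = P"
proof -
  have cl: "{y \<in> {1..n}. root (arcs P) y = root (arcs P) x} = B" if B: "B \<in> P" "x \<in> B" for x B
  proof
    show "B \<subseteq> {y \<in> {1..n}. root (arcs P) y = root (arcs P) x}"
    proof
      fix y assume y: "y \<in> B"
      have "y \<in> {1..n}" using in_block[OF P B(1) y] .
      thus "y \<in> {y \<in> {1..n}. root (arcs P) y = root (arcs P) x}"
        using root_arcs[OF P B(1) B(2)] root_arcs[OF P B(1) y] by simp
    qed
    show "{y \<in> {1..n}. root (arcs P) y = root (arcs P) x} \<subseteq> B"
    proof safe
      fix y assume y: "y \<in> {1..n}" "root (arcs P) y = root (arcs P) x"
      then obtain C where C: "C \<in> P" "y \<in> C" using block_of[OF P y(1)] by blast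
      hence "Min C = Min B" using root_arcs[OF P B] root_arcs[OF P C] y(2) by simp
      moreover have "Min D \<in> D" if "D \<in> P" for D
        using finite_block[OF P that] partition_onD3[OF P] that by (metis Min_in)
      hence "Min B \<in> B" "Min C \<in> C" using B C by blast+
      ultimately have "B = C" using block_eqI[OF P B(1) C(1), of "Min B"] by simp
      thus "y \<in> B" using C by simp
    qed
  qed
  show ?thesis
  proof
    show "blocks n (arcs P) \<subseteq> P"
    proof
      fix B assume "B \<in> blocks n (arcs P)"
      then obtain x where x: "x \<in> {1..n}"
        "B = {y \<in> {1..n}. root (arcs P) y = root (arcs P) x}" by (auto simp: blocks_def)
      then obtain C where "C \<in> P" "x \<in> C" using block_of[OF P x(1)] by blast
      thus "B \<in> P" using cl x by simp
    qed
    show "P \<subseteq> blocks n (arcs P)"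
    proof
      fix B assume B: "B \<in> P"
      then obtain x where x: "x \<in> B" using partition_onD3[OF P] by (metis all_not_in_conv)
      have "x \<in> {1..n}" using in_block[OF P B x] .
      thus "B \<in> blocks n (arcs P)" unfolding blocks_def using cl[OF B x] by blast
    qed
  qed
qed

section \<open>From labels to left-hand endpoints\<close>

lemma asc_eq_card: "asc w = card {i. Suc i < length w \<and> w ! i < w ! Suc i}"
proof (induction w rule: asc.induct)
  case (1 x y w)
  let ?A = "\<lambda>w. {i. Suc i < length w \<and> w ! i < w ! Suc i}"
  have fin: "finite (?A (y # w))" by (rule finite_subset[of _ "{..length (y # w)}"]) auto
  have "?A (x # y # w) = (if x < y then {0} else {}) \<union> Suc ` ?A (y # w)"
  proof (rule set_eqI)
    fix i show "i \<in> ?A (x # y # w) \<longleftrightarrow> i \<in> (if x < y then {0} else {}) \<union> Suc ` ?A (y # w)"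
      by (cases i) auto
  qed
  moreover have "card \<dots> = of_bool (x < y) + card (?A (y # w))"
    using fin by (auto simp: card_image)
  ultimately show ?case using 1 by simp
qed simp_all

lemma des_map_antitone:
  assumes "\<And>a b. a \<in> set w \<Longrightarrow> b \<in> set w \<Longrightarrow> f b < f a \<longleftrightarrow> a < b"
  shows "des (map f w) = asc w"
  unfolding des_def asc_eq_card using assms
  by (intro arg_cong[of _ _ card] Collect_cong) auto

lemma word_pmaj_eq_sum:
  "length R = length W \<Longrightarrow>
    word_pmaj R W = (\<Sum>j<length R. asc (filter (\<lambda>l. l < R ! j) (drop j W)))"
proof (induction R W rule: list_induct2)
  case (Cons r R x W)
  thus ?case by (simp add: sum.lessThan_Suc_shift del: filter.simps sum.lessThan_Suc)
qed simp

definition arc_word :: "nat set set \<Rightarrow> nat list" where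
  "arc_word P = map (\<lambda>r. THE l. (l, r) \<in> arcs P) (sorted_list_of_set (snd ` arcs P))"

lemma left_end_eq: "arc_diagram E \<Longrightarrow> (l, r) \<in> E \<Longrightarrow> (THE l. (l, r) \<in> E) = l"
  by (rule the_equality) (auto dest: arc_diagramD(2))

lemma arc_word_in_arc_words:
  assumes E: "arc_diagram (arcs P)" and fin: "finite (arcs P)"
  shows "arc_word P \<in> arc_words (sorted_list_of_set (snd ` arcs P)) (fst ` arcs P)"
    and "set (zip (arc_word P) (sorted_list_of_set (snd ` arcs P))) = arcs P"
proof -
  let ?R = "sorted_list_of_set (snd ` arcs P)" and ?left = "\<lambda>r. THE l. (l, r) \<in> arcs P"
  have R: "set ?R = snd ` arcs P" "distinct ?R" using fin by simp_all
  have left: "(?left r, r) \<in> arcs P" if "r \<in> snd ` arcs P" for r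
    using that left_end_eq[OF E] by auto
  have "inj_on ?left (snd ` arcs P)"
    by (rule inj_onI) (metis left arc_diagramD(3)[OF E])
  moreover have "?left ` snd ` arcs P = fst ` arcs P"
    unfolding image_image by (rule image_cong[OF refl]) (use left_end_eq[OF E] in force)
  moreover have "list_all2 (<) (arc_word P) ?R"
  proof (rule list_all2_all_nthI)
    fix j assume "j < length (arc_word P)"
    hence j: "j < length ?R" by (simp add: arc_word_def)
    hence "?R ! j \<in> snd ` arcs P" using R(1) by (metis nth_mem)
    thus "arc_word P ! j < ?R ! j" using arc_diagramD(1)[OF E left] j by (simp add: arc_word_def)
  qed (simp add: arc_word_def)
  ultimately show "arc_word P \<in> arc_words ?R (fst ` arcs P)"
    using R by (simp add: arc_words_def arc_word_def distinct_map)
  have "set (zip (arc_word P) ?R) = (\<lambda>r. (?left r, r)) ` snd ` arcs P"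
    unfolding arc_word_def zip_map1 using R by (auto simp: zip_same_conv_map)
  also have "\<dots> = id ` arcs P" unfolding image_image
    by (rule image_cong[OF refl]) (auto simp: left_end_eq[OF E])
  also have "\<dots> = arcs P" by simp
  finally show "set (zip (arc_word P) ?R) = arcs P" .
qed

lemma arc_label_eq:
  assumes "arc_diagram (arcs P)"
  shows "arc_label P a = card {l \<in> fst ` arcs P. fst a \<le> l}"
proof -
  have "inj_on fst {b \<in> arcs P. fst a \<le> fst b}"
    using assms by (auto simp: arc_diagram_def inj_on_def)
  hence "arc_label P a = card (fst ` {b \<in> arcs P. fst a \<le> fst b})"
    unfolding arc_label_def by (simp add: card_image)
  also have "fst ` {b \<in> arcs P. fst a \<le> fst b} = {l \<in> fst ` arcs P. fst a \<le> l}" by auto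
  finally show ?thesis .
qed

text \<open>The cardinality is the label of an arc with left-hand endpoint \<open>l\<close> when \<open>L\<close> is the set of all
  left-hand endpoints.\<close>

lemma label_antitone:
  assumes "finite L" "l \<in> L" "l' \<in> (L :: nat set)"
  shows "card {x \<in> L. l' \<le> x} < card {x \<in> L. l \<le> x} \<longleftrightarrow> l < l'"
proof -
  have *: "card {x \<in> L. b \<le> x} < card {x \<in> L. a \<le> x}" if "a < b" "a \<in> L" for a b
  proof (rule psubset_card_mono)
    have "a \<in> {x \<in> L. a \<le> x} - {x \<in> L. b \<le> x}" using that by simp
    thus "{x \<in> L. b \<le> x} \<subset> {x \<in> L. a \<le> x}" using that(1) by fastforce
  qed (use assms(1) in simp)
  show ?thesis using *[of l l'] *[of l' l] assms by (metis linorder_neqE_nat not_less_iff_gr_or_eq)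
qed

text \<open>The deletions accumulate: after the step to the right-hand endpoint \<open>R ! j\<close>, exactly the labels
  of left-hand endpoints at or above \<open>R ! j\<close> have been removed. The index \<open>j\<close> runs backwards because
  \<open>sigma\<close> starts at the largest right-hand endpoint, whereas \<open>R\<close> is increasing.\<close>

lemma sigma_eq:
  assumes E: "arc_diagram (arcs P)" and fin: "finite (arcs P)" and i: "i < card (arcs P)"
  defines "L \<equiv> fst ` arcs P" and "R \<equiv> sorted_list_of_set (snd ` arcs P)"
    and "j \<equiv> card (arcs P) - Suc i"
  shows "sigma P i =
    map (\<lambda>l. card {x \<in> L. l \<le> x}) (filter (\<lambda>l. l < R ! j) (drop j (arc_word P)))"
  using i unfolding j_def
proof (induction i)
  let ?k = "card (arcs P)" and ?W = "arc_word P" and ?lab = "\<lambda>l. card {x \<in> L. l \<le> x}"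
  have Rset: "set R = snd ` arcs P" and Rsorted: "sorted_wrt (<) R"
    using fin by (simp_all add: R_def)
  have lenR: "length R = ?k" using E by (simp add: R_def arc_diagram_def card_image)
  have W: "set ?W = L" "list_all2 (<) ?W R"
    using arc_word_in_arc_words(1)[OF E fin] by (simp_all add: arc_words_def L_def R_def)
  have lenW: "length ?W = ?k" using list_all2_lengthD[OF W(2)] lenR by simp
  have WR: "?W ! m < R ! m" if "m < ?k" for m
    using list_all2_nthD[OF W(2)] that lenW by simp
  have right: "right_end P i = R ! (?k - Suc i)" if "i < ?k" for i
    using that lenR by (simp add: right_end_def rev_nth flip: R_def)
  have label: "label_at_right_end P (R ! m) = ?lab (?W ! m)" if m: "m < ?k" for m
  proof -
    have "R ! m \<in> snd ` arcs P" using m lenR Rset by (metis nth_mem)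
    then obtain l where l: "(l, R ! m) \<in> arcs P" by auto
    have "(THE a. a \<in> arcs P \<and> snd a = R ! m) = (l, R ! m)"
      using l arc_diagramD(2)[OF E] by (intro the_equality) auto
    moreover have "?W ! m = l"
      using left_end_eq[OF E l] m lenR by (simp add: arc_word_def flip: R_def)
    ultimately show ?thesis by (simp add: label_at_right_end_def arc_label_eq[OF E] L_def)
  qed
  have inj: "inj_on ?lab L"
    using label_antitone[of L] fin by (intro linorder_inj_onI') (auto simp: L_def; fastforce)
  {
    case 0
    hence k: "?k - Suc 0 < ?k" by simp
    have "drop (?k - Suc 0) ?W = [?W ! (?k - Suc 0)]"
      using Cons_nth_drop_Suc[of "?k - Suc 0" ?W] lenW k by simp
    thus ?case using right[OF 0] label[OF k] WR[OF k] by simp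
  next
    case (Suc i)
    define m where "m = ?k - Suc (Suc i)"
    have m: "m < ?k" "Suc m < ?k" "?k - Suc i = Suc m" using Suc.prems by (auto simp: m_def)
    have lt: "R ! m < R ! Suc m" using Rsorted m lenR by (simp add: sorted_wrt_nth_less)
    have IH: "sigma P i = map ?lab (filter (\<lambda>l. l < R ! Suc m) (drop (Suc m) ?W))"
      using Suc m by simp
    have r: "right_end P (Suc i) = R ! m" "right_end P i = R ! Suc m"
      using right[of "Suc i"] right[of i] Suc.prems m by (simp_all add: m_def)
    define D where "D = {l \<in> L. R ! m \<le> l \<and> l < R ! Suc m}"
    have "arc_label P ` {a \<in> arcs P. R ! m \<le> fst a \<and> fst a < R ! Suc m} = ?lab ` D"
      unfolding D_def L_def arc_label_eq[OF E] by (auto simp: image_iff)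
    hence "sigma P (Suc i) = ?lab (?W ! m) # filter (\<lambda>c. c \<notin> ?lab ` D) (sigma P i)"
      by (simp add: r label[OF m(1)])
    also have "filter (\<lambda>c. c \<notin> ?lab ` D) (sigma P i) =
        map ?lab (filter (\<lambda>l. l < R ! m) (drop (Suc m) ?W))"
    proof -
      have "(?lab l \<notin> ?lab ` D \<and> l < R ! Suc m) = (l < R ! m)" if "l \<in> set (drop (Suc m) ?W)" for l
      proof -
        have "l \<in> L" using that W(1) by (auto dest: in_set_dropD)
        hence "?lab l \<in> ?lab ` D \<longleftrightarrow> l \<in> D"
          by (intro inj_on_image_mem_iff[OF inj]) (auto simp: D_def)
        thus ?thesis using \<open>l \<in> L\<close> lt by (auto simp: D_def)
      qed
      thus ?thesis unfolding IH filter_map filter_filter o_def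
        by (intro arg_cong[of _ _ "map ?lab"] filter_cong refl) blast
    qed
    also have "?lab (?W ! m) # \<dots> = map ?lab (filter (\<lambda>l. l < R ! m) (drop m ?W))"
      using Cons_nth_drop_Suc[of m ?W] lenW m WR[OF m(1)] by (simp flip: Cons_nth_drop_Suc)
    finally show ?case by (simp add: m_def)
  }
qed

lemma pmaj_eq_word_pmaj:
  assumes E: "arc_diagram (arcs P)" and fin: "finite (arcs P)"
  shows "pmaj P = word_pmaj (sorted_list_of_set (snd ` arcs P)) (arc_word P)"
proof -
  let ?L = "fst ` arcs P" and ?R = "sorted_list_of_set (snd ` arcs P)" and ?W = "arc_word P"
  let ?k = "card (arcs P)" and ?w = "\<lambda>j. filter (\<lambda>l. l < ?R ! j) (drop j ?W)"
  have W: "set ?W = ?L" "length ?R = length ?W"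
    using arc_word_in_arc_words(1)[OF E fin] by (auto simp: arc_words_def dest: list_all2_lengthD)
  have k: "length ?R = ?k" using E by (simp add: arc_diagram_def card_image)
  have "des (sigma P i) = asc (?w (?k - Suc i))" if "i < ?k" for i
    unfolding sigma_eq[OF E fin that]
  proof (rule des_map_antitone)
    fix a b assume "a \<in> set (?w (?k - Suc i))" "b \<in> set (?w (?k - Suc i))"
    hence "a \<in> ?L" "b \<in> ?L" using W(1) by (auto dest: in_set_dropD)
    thus "card {x \<in> ?L. b \<le> x} < card {x \<in> ?L. a \<le> x} \<longleftrightarrow> a < b"
      using fin by (intro label_antitone) simp_all
  qed
  hence "pmaj P = (\<Sum>i<?k. asc (?w (?k - Suc i)))" by (simp add: pmaj_def)
  also have "\<dots> = (\<Sum>j<?k. asc (?w j))" by (rule sum.nat_diff_reindex)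
  finally show ?thesis using W(2) k by (simp add: word_pmaj_eq_sum)
qed

section \<open>The generating function\<close>

lemma arc_diagram_zip:
  assumes "W \<in> arc_words R L" and "distinct R"
  shows "arc_diagram (set (zip W R))" "fst ` set (zip W R) = L" "snd ` set (zip W R) = set R"
proof -
  have W: "distinct W" "set W = L" "list_all2 (<) W R" "length W = length R"
    using assms(1) by (auto simp: arc_words_def dest: list_all2_lengthD)
  have maps: "map fst (zip W R) = W" "map snd (zip W R) = R" using W(4) by simp_all
  have "inj_on fst (set (zip W R))" "inj_on snd (set (zip W R))"
    using maps W(1) assms(2) by (metis distinct_map)+
  thus "arc_diagram (set (zip W R))"
    using W(3) by (auto simp: arc_diagram_def list_all2_iff)
  show "fst ` set (zip W R) = L" using maps(1) W(2) by (metis set_map)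
  show "snd ` set (zip W R) = set R" using maps(2) by (metis set_map)
qed

text \<open>Minima are the vertices that end no arc and maxima those that start none, so prescribing \<open>S\<close> and
  \<open>T\<close> means prescribing the sets of right-hand and left-hand endpoints. The correspondence between
  partitions and words is then the one between partitions and arc diagrams.\<close>

lemma sum_partitions_min_max:
  fixes y :: "'b::comm_semiring_1"
  assumes S: "S \<subseteq> {1..n}" and T: "T \<subseteq> {1..n}"
  defines "R \<equiv> sorted_list_of_set ({1..n} - S)" and "L \<equiv> {1..n} - T"
  shows "(\<Sum>P\<in>partitions_min_max n S T. y ^ pmaj P) = (\<Sum>W\<in>arc_words R L. y ^ word_pmaj R W)"
proof (rule sum.reindex_bij_witness[where j = arc_word and i = "\<lambda>W. blocks n (set (zip W R))"])
  fix P assume "P \<in> partitions_min_max n S T"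
  hence P: "partition_on {1..n} P" and ends: "Min ` P = S" "Max ` P = T"
    by (auto simp: partitions_min_max_def)
  note E = arc_diagram_arcs[OF P]
  have sub: "arcs P \<subseteq> {1..n} \<times> {1..n}" by (rule arcs_subset[OF P])
  hence fin: "finite (arcs P)" by (rule finite_subset) simp
  have "snd ` arcs P \<subseteq> {1..n}" "fst ` arcs P \<subseteq> {1..n}" using sub by force+
  hence RL: "snd ` arcs P = {1..n} - S" "fst ` arcs P = L"
    using Min_Max_arcs[OF P] ends unfolding L_def by blast+
  note facts = arc_word_in_arc_words[OF E fin, unfolded RL, folded R_def]
  show "blocks n (set (zip (arc_word P) R)) = P" using facts(2) blocks_arcs[OF P] by simp
  show "arc_word P \<in> arc_words R L" by (rule facts(1))
  show "y ^ word_pmaj R (arc_word P) = y ^ pmaj P"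
    using pmaj_eq_word_pmaj[OF E fin] by (simp add: RL R_def)
next
  fix W assume W: "W \<in> arc_words R L"
  let ?E = "set (zip W R)"
  have R: "set R = {1..n} - S" "distinct R" by (simp_all add: R_def)
  note E = arc_diagram_zip[OF W R(2)]
  have "?E \<subseteq> L \<times> set R" using E by force
  hence sub: "?E \<subseteq> {1..n} \<times> {1..n}" using R by (auto simp: L_def)
  note arcs = arcs_blocks[OF E(1) sub]
  have P: "partition_on {1..n} (blocks n ?E)" by (rule partition_on_blocks)
  have "Min ` blocks n ?E = S" "Max ` blocks n ?E = T"
    using Min_Max_arcs[OF P] S T R(1) unfolding arcs E L_def by blast+
  thus "blocks n ?E \<in> partitions_min_max n S T" using P by (simp add: partitions_min_max_def)
  have len: "length W = length R" using W by (auto simp: arc_words_def dest: list_all2_lengthD)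
  have "arc_word (blocks n ?E) = map (\<lambda>r. THE l. (l, r) \<in> ?E) R"
    unfolding arc_word_def arcs E using R by (simp add: R_def)
  also have "\<dots> = W"
  proof (rule nth_equalityI)
    fix m assume "m < length (map (\<lambda>r. THE l. (l, r) \<in> ?E) R)"
    hence m: "m < length R" by simp
    hence "(W ! m, R ! m) \<in> ?E" using len by (auto simp: set_zip)
    thus "map (\<lambda>r. THE l. (l, r) \<in> ?E) R ! m = W ! m" using left_end_eq[OF E(1)] m by simp
  qed (simp add: len)
  finally show "arc_word (blocks n ?E) = W" .
qed

theorem theorem2:
  fixes n :: nat and S T :: "nat set"
  assumes "n \<ge> 1" and "S \<subseteq> {1..n}" and "T \<subseteq> {1..n}" and "card S = card T"
  shows "(\<Sum>P\<in>partitions_min_max n S T. monom (1::int) (pmaj P)) =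
    (\<Prod>i\<in>{1..n} - T. \<Sum>k | int k \<le> height n S T i - 1. monom 1 k)"
proof -
  define y :: "int poly" where "y = monom 1 1"
  have y: "monom 1 k = y ^ k" for k by (simp add: y_def monom_power)
  let ?R = "sorted_list_of_set ({1..n} - S)"
  have fin: "finite S" "finite T" using assms(2,3) finite_subset by blast+
  have "card ({1..n} - T) = length ?R"
    using assms(2-4) fin by (simp add: card_Diff_subset)
  hence "(\<Sum>P\<in>partitions_min_max n S T. y ^ pmaj P) =
      (\<Prod>i\<in>{1..n} - T. \<Sum>k<card {r\<in>set ?R. i < r} - card {l\<in>{1..n} - T. i < l}. y ^ k)"
    unfolding sum_partitions_min_max[OF assms(2,3)] by (intro sum_word_pmaj) simp_all
  also have "\<dots> = (\<Prod>i\<in>{1..n} - T. \<Sum>k | int k \<le> height n S T i - 1. y ^ k)"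
  proof (rule prod.cong[OF refl], rule sum.cong)
    fix i
    have count: "card {x\<in>{1..n} - A. i < x} + card (A \<inter> {i+1..n}) = n - i"
      if "A \<subseteq> {1..n}" for A
    proof -
      have "card {x\<in>{1..n} - A. i < x} + card (A \<inter> {i+1..n}) =
          card ({x\<in>{1..n} - A. i < x} \<union> A \<inter> {i+1..n})"
        by (rule card_Un_disjoint[symmetric]) auto
      also have "{x\<in>{1..n} - A. i < x} \<union> A \<inter> {i+1..n} = {i+1..n}" by auto
      finally show ?thesis by simp
    qed
    \<comment> \<open>Complementation in \<open>{i+1..n}\<close> exchanges the roles of the two sets, so the difference keeps its sign.\<close>
    have "int (card {r\<in>{1..n} - S. i < r}) - int (card {l\<in>{1..n} - T. i < l}) = height n S T i"
      using count[OF assms(2)] count[OF assms(3)] unfolding height_def by linarith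
    thus "{..<card {r\<in>set ?R. i < r} - card {l\<in>{1..n} - T. i < l}} =
        {k. int k \<le> height n S T i - 1}" by auto
  qed simp
  finally show ?thesis unfolding y .
qed

end
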